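(* Let $G\leq\mathrm{GL}(d,\mathbb{R})$ be a finite group for which generating points exist, and let $v$ and $w$ be generating points for $G$. Let $K=\mathbb{R}(X_1,\dotsc,X_d)$. Then the representations $D_X$ and $D_v$ of the group $\mathrm{LinSym}((gX)_{g\in G})$ are similar over $K$, and the representations $D_v$ and $D_w$ are similar over $\mathbb{R}$; that is, there exist $S\in\mathrm{GL}(d,K)$ and $T\in\mathrm{GL}(d,\mathbb{R})$ such that \[D_v(\sigma)=S^{-1}D_X(\sigma)S=T^{-1}D_w(\sigma)T\] for all $\sigma\in\mathrm{LinSym}((gX)_{g\in G})$. In particular, the evaluation homomorphism $\operatorname{eval}_v\colon\mathrm{GL}(GX)\to\mathrm{GL}(Gv)$ is injective for every generating point $v$.
   Context: A point $v\in\mathbb{R}^d$ is a generating point for $G$ if the affine hull of $\{gv\mid g\in G\}$ is $\mathbb{R}^d$. For a field $K$, a finite set $I$ and a family $(v_i)_{i\in I}$ of vectors in $K^d$, put $\mathrm{LinSym}((v_i)_i)=\{\sigma\in\mathrm{Sym}(I)\mid \exists A\in\mathrm{GL}(d,K)\ \forall i\in I:\ Av_i=v_{\sigma(i)}\}$. For a set $S$ of vectors spanning $K^d$, $\mathrm{GL}(S)$ denotes the group of all $A\in\mathrm{GL}(d,K)$ mapping $S$ onto itself. $X=(X_1,\dotsc,X_d)^t$ is a vector of indeterminates, viewed as an element of $K^d$ with $K=\mathbb{R}(X_1,\dotsc,X_d)$, and $GX=\{gX\mid g\in G\}\subset K^d$, $Gv=\{gv\mid g\in G\}\subset\mathbb{R}^d$.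 When generating points exist, $GX$ spans $K^d$ over $K$, and for each $\sigma\in\mathrm{LinSym}((gX)_{g\in G})$ there is a unique matrix $A_\sigma(X)\in\mathrm{GL}(d,K)$ with $A_\sigma(X)gX=\sigma(g)X$ for all $g\in G$; the map $D_X\colon\sigma\mapsto A_\sigma(X)$ is a group isomorphism $\mathrm{LinSym}((gX)_{g\in G})\to\mathrm{GL}(GX)\subseteq\mathrm{GL}(d,K)$. For every generating point $v$, the entries of the matrices in $\mathrm{GL}(GX)$ can be evaluated at $X=v$, and this evaluation defines a group homomorphism $\operatorname{eval}_v\colon\mathrm{GL}(GX)\to\mathrm{GL}(Gv)\subseteq\mathrm{GL}(d,\mathbb{R})$. Put $D_v=\operatorname{eval}_v\circ D_X\colon\mathrm{LinSym}((gX)_{g\in G})\to\mathrm{GL}(d,\mathbb{R})$. *)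

theory Defs
  imports
    "HOL-Analysis.Analysis"
    "HOL-Algebra.Group"
    "HOL-Library.Poly_Mapping"
    "HOL-Computational_Algebra.Fraction_Field"
begin

section \<open>General linear groups and linear symmetries\<close>

definition GL :: "('a::field ^ 'n ^ 'n) monoid" where
  "GL = \<lparr>carrier = {A. invertible A}, mult = (**), one = mat 1\<rparr>"

definition GL_stab :: "('a::field ^ 'n) set \<Rightarrow> ('a ^ 'n ^ 'n) monoid" where
  "GL_stab S = \<lparr>carrier = {A. invertible A \<and> (\<lambda>x. A *v x) ` S = S}, mult = (**), one = mat 1\<rparr>"

text \<open>The symmetric group on \<open>I\<close> is represented by the functions that permute \<open>I\<close> and fix
  everything outside \<open>I\<close>.\<close>

definition LinSym :: "'i set \<Rightarrow> ('i \<Rightarrow> 'a::field ^ 'n) \<Rightarrow> ('i \<Rightarrow> 'i) set" where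
  "LinSym I v = {\<sigma>. \<sigma> permutes I \<and> (\<exists>A. invertible A \<and> (\<forall>i\<in>I. A *v v i = v (\<sigma> i)))}"

definition orbit_of :: "('a::field ^ 'n ^ 'n) set \<Rightarrow> 'a ^ 'n \<Rightarrow> ('a ^ 'n) set" where
  "orbit_of G v = (\<lambda>g. g *v v) ` G"

definition generating_point :: "(real ^ 'n ^ 'n) set \<Rightarrow> real ^ 'n \<Rightarrow> bool" where
  "generating_point G v \<longleftrightarrow> affine hull (orbit_of G v) = UNIV"


section \<open>Rational functions in the coordinates\<close>

text \<open>The variables are indexed by the same type \<open>'n\<close> as the coordinates. The linear order on
  \<open>'n\<close>, which exists on every finite type, is only there because the library's instance
  making polynomials an integral domain requires one.\<close>

type_synonym 'n mpoly = "('n \<Rightarrow>\<^sub>0 nat) \<Rightarrow>\<^sub>0 real"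
type_synonym 'n ratfun = "'n mpoly fract"

definition peval :: "real ^ 'n \<Rightarrow> 'n mpoly \<Rightarrow> real" where
  "peval v p = (\<Sum>m\<in>Poly_Mapping.keys p. poly_mapping.lookup p m * (\<Prod>i\<in>UNIV. (v $ i) ^ poly_mapping.lookup m i))"

definition rconst :: "real \<Rightarrow> 'n::{finite,linorder} ratfun" where
  "rconst c = Fract (Poly_Mapping.single 0 c) 1"

definition Xvec :: "'n ratfun ^ 'n::{finite,linorder}" where
  "Xvec = (\<chi> i. Fract (Poly_Mapping.single (Poly_Mapping.single i 1) 1) 1)"

definition cmat :: "real ^ 'n::{finite,linorder} ^ 'n::_ \<Rightarrow> 'n ratfun ^ 'n::_ ^ 'n::_" where
  "cmat = map_matrix rconst"

text \<open>The value of \<open>f\<close> at \<open>v\<close> is computed from any fraction representing \<open>f\<close> whose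
  denominator does not vanish at \<open>v\<close> (\<open>rat_eval_Fract\<close> below); it is unspecified if there is none.\<close>

definition evaluable :: "real ^ 'n::{finite,linorder} \<Rightarrow> 'n ratfun \<Rightarrow> bool" where
  "evaluable v f \<longleftrightarrow> (\<exists>p q. f = Fract p q \<and> peval v q \<noteq> 0)"

definition rat_eval :: "real ^ 'n::{finite,linorder} \<Rightarrow> 'n ratfun \<Rightarrow> real" where
  "rat_eval v f = (THE c. \<exists>p q. f = Fract p q \<and> peval v q \<noteq> 0 \<and> c = peval v p / peval v q)"

definition eval_mat :: "real ^ 'n::{finite,linorder} \<Rightarrow> 'n ratfun ^ 'n::_ ^ 'n::_ \<Rightarrow> real ^ 'n::_ ^ 'n::_" where
  "eval_mat v = map_matrix (rat_eval v)"


section \<open>The representations\<close>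

definition orbit_X :: "(real ^ 'n::{finite,linorder} ^ 'n::_) set \<Rightarrow> ('n ratfun ^ 'n::_) set" where
  "orbit_X G = orbit_of (cmat ` G) Xvec"

definition LinSym_X :: "(real ^ 'n::{finite,linorder} ^ 'n::_) set
    \<Rightarrow> (real ^ 'n::_ ^ 'n::_ \<Rightarrow> real ^ 'n::_ ^ 'n::_) set" where
  "LinSym_X G = LinSym G (\<lambda>g. cmat g *v Xvec)"

text \<open>If generating points exist, the description determines a unique matrix, and its entries can
  be evaluated at every generating point (\<open>D_X_unique\<close> and \<open>D_X_evaluable\<close> below).\<close>

definition D_X :: "(real ^ 'n::{finite,linorder} ^ 'n::_) set \<Rightarrow> (real ^ 'n::_ ^ 'n::_ \<Rightarrow> real ^ 'n::_ ^ 'n::_)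
    \<Rightarrow> 'n ratfun ^ 'n::_ ^ 'n::_" where
  "D_X G \<sigma> = (THE A. invertible A \<and> (\<forall>g\<in>G. A *v (cmat g *v Xvec) = cmat (\<sigma> g) *v Xvec))"

definition D_at :: "(real ^ 'n::{finite,linorder} ^ 'n::_) set \<Rightarrow> real ^ 'n::_ \<Rightarrow> (real ^ 'n::_ ^ 'n::_ \<Rightarrow> real ^ 'n::_ ^ 'n::_)
    \<Rightarrow> real ^ 'n::_ ^ 'n::_" where
  "D_at G v = eval_mat v \<circ> D_X G"


section \<open>Well-definedness\<close>

lemma peval_superset:
  assumes "finite F" "Poly_Mapping.keys p \<subseteq> F"
  shows "peval v p = (\<Sum>m\<in>F. poly_mapping.lookup p m * (\<Prod>i\<in>UNIV. (v $ i) ^ poly_mapping.lookup m i))"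
  unfolding peval_def using assms
  by (intro sum.mono_neutral_left) (auto simp: in_keys_iff)

lemma peval_0 [simp]: "peval v 0 = 0"
  by (simp add: peval_def)

lemma peval_single: "peval v (Poly_Mapping.single m c) = c * (\<Prod>i\<in>UNIV. (v $ i) ^ poly_mapping.lookup m i)"
  by (subst peval_superset[of "{m}"]) auto

lemma peval_1 [simp]: "peval v 1 = 1"
  using peval_single[of v 0 1] by simp

lemma peval_add: "peval v (p + q) = peval v p + peval v q"
proof -
  let ?F = "Poly_Mapping.keys p \<union> Poly_Mapping.keys q"
  have *: "Poly_Mapping.keys (p + q) \<subseteq> ?F"
    by (rule keys_add)
  have "peval v (p + q) = (\<Sum>m\<in>?F. poly_mapping.lookup (p + q) m * (\<Prod>i\<in>UNIV. (v $ i) ^ poly_mapping.lookup m i))"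
    by (rule peval_superset[OF _ *]) auto
  also have "\<dots> = peval v p + peval v q"
    by (subst (1 2) peval_superset[of ?F]) (auto simp: lookup_add algebra_simps sum.distrib)
  finally show ?thesis .
qed

lemma peval_sum: "peval v (\<Sum>x\<in>S. f x) = (\<Sum>x\<in>S. peval v (f x))"
  by (induction S rule: infinite_finite_induct) (auto simp: peval_add)

lemma mpoly_eq_sum: "p = (\<Sum>m\<in>Poly_Mapping.keys p. Poly_Mapping.single m (poly_mapping.lookup p m))"
  by (rule poly_mapping_eqI)
    (auto simp: lookup_sum lookup_single when_def in_keys_iff sum.delta)

lemma peval_mult: "peval v (p * q) = peval v p * peval v q"
proof -
  have "p * q = (\<Sum>m\<in>Poly_Mapping.keys p. \<Sum>k\<in>Poly_Mapping.keys q. Poly_Mapping.single (m + k) (poly_mapping.lookup p m * poly_mapping.lookup q k))"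
    by (subst mpoly_eq_sum[of p], subst mpoly_eq_sum[of q])
      (simp add: sum_product mult_single)
  then have "peval v (p * q) = (\<Sum>m\<in>Poly_Mapping.keys p. \<Sum>k\<in>Poly_Mapping.keys q.
      (poly_mapping.lookup p m * poly_mapping.lookup q k) * (\<Prod>i\<in>UNIV. (v $ i) ^ poly_mapping.lookup (m + k) i))"
    by (simp add: peval_sum peval_single)
  also have "\<dots> = peval v p * peval v q"
    unfolding peval_def sum_product
    by (intro sum.cong refl) (simp add: lookup_add power_add prod.distrib algebra_simps)
  finally show ?thesis .
qed

lemma rat_eval_Fract:
  assumes "peval v q \<noteq> 0"
  shows "rat_eval v (Fract p q) = peval v p / peval v q"
  unfolding rat_eval_def
proof (rule the_equality)
  fix c assume "\<exists>p' q'. Fract p q = Fract p' q' \<and> peval v q' \<noteq> 0 \<and> c = peval v p' / peval v q'"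
  then obtain p' q' where *: "Fract p q = Fract p' q'" "peval v q' \<noteq> 0"
    "c = peval v p' / peval v q'" by blast
  moreover have "q \<noteq> 0" "q' \<noteq> 0"
    using assms * by auto
  ultimately have "p * q' = p' * q"
    by (simp add: eq_fract)
  then have "peval v p * peval v q' = peval v p' * peval v q"
    by (metis peval_mult)
  also have "peval v p' = c * peval v q'"
    using * by simp
  finally have "peval v p = c * peval v q"
    using *(2) by simp
  then show "c = peval v p / peval v q"
    using assms by simp
qed (use assms in auto)

lemma evaluable_Fract: "peval v q \<noteq> 0 \<Longrightarrow> evaluable v (Fract p q)"
  by (auto simp: evaluable_def)

lemma evaluable_E:
  assumes "evaluable v f"
  obtains p q where "f = Fract p q" "q \<noteq> 0" "peval v q \<noteq> 0"
  using assms by (metis evaluable_def peval_0)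

lemma evaluable_rconst [simp]: "evaluable v (rconst c)" "rat_eval v (rconst c) = c"
  by (auto simp: rconst_def evaluable_Fract rat_eval_Fract peval_single)

lemma evaluable_Xvec [simp]: "evaluable v (Xvec $ i)" "rat_eval v (Xvec $ i) = v $ i"
proof -
  have "(\<Prod>j\<in>UNIV. (v $ j) ^ poly_mapping.lookup (Poly_Mapping.single i 1) j) = (\<Prod>j\<in>UNIV. if j = i then v $ j else 1)"
    by (intro prod.cong) (auto simp: lookup_single when_def)
  also have "\<dots> = v $ i"
    by (simp add: prod.delta)
  finally show "evaluable v (Xvec $ i)" "rat_eval v (Xvec $ i) = v $ i"
    by (auto simp: Xvec_def evaluable_Fract rat_eval_Fract peval_single)
qed

lemma evaluable_add:
  assumes "evaluable v f" "evaluable v g"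
  shows "evaluable v (f + g) \<and> rat_eval v (f + g) = rat_eval v f + rat_eval v g"
  using assms
  by (elim evaluable_E)
    (auto simp: evaluable_Fract rat_eval_Fract peval_mult peval_add field_simps)

lemma evaluable_mult:
  assumes "evaluable v f" "evaluable v g"
  shows "evaluable v (f * g) \<and> rat_eval v (f * g) = rat_eval v f * rat_eval v g"
  using assms
  by (elim evaluable_E) (auto simp: evaluable_Fract rat_eval_Fract peval_mult)

lemma evaluable_0: "evaluable v 0 \<and> rat_eval v 0 = 0"
  unfolding Zero_fract_def by (simp add: evaluable_Fract rat_eval_Fract)

lemma evaluable_1: "evaluable v 1 \<and> rat_eval v 1 = 1"
  unfolding One_fract_def by (simp add: evaluable_Fract rat_eval_Fract)

lemma evaluable_uminus:
  assumes "evaluable v f"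
  shows "evaluable v (- f) \<and> rat_eval v (- f) = - rat_eval v f"
proof -
  have "peval v (- p) = - peval v p" for p
    using peval_add[of v p "- p"] by simp
  then show ?thesis
    using assms by (elim evaluable_E) (auto simp: evaluable_Fract rat_eval_Fract)
qed

lemma evaluable_divide:
  assumes "evaluable v f" "evaluable v g" "rat_eval v g \<noteq> 0"
  shows "evaluable v (f / g)"
  using assms
  by (elim evaluable_E) (auto simp: rat_eval_Fract peval_mult intro!: evaluable_Fract)

lemma evaluable_sum:
  assumes "\<And>x. x \<in> S \<Longrightarrow> evaluable v (f x)"
  shows "evaluable v (sum f S) \<and> rat_eval v (sum f S) = (\<Sum>x\<in>S. rat_eval v (f x))"
  using assms by (induction S rule: infinite_finite_induct) (auto simp: evaluable_0 evaluable_add)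

lemma evaluable_prod:
  assumes "\<And>x. x \<in> S \<Longrightarrow> evaluable v (f x)"
  shows "evaluable v (prod f S) \<and> rat_eval v (prod f S) = (\<Prod>x\<in>S. rat_eval v (f x))"
  using assms by (induction S rule: infinite_finite_induct) (auto simp: evaluable_1 evaluable_mult)

lemma evaluable_det:
  assumes "\<And>i j. evaluable v (A $ i $ j)"
  shows "evaluable v (det A)" "rat_eval v (det A) = det (eval_mat v A)"
proof -
  have sgn: "evaluable v (of_int (sign p)) \<and> rat_eval v (of_int (sign p)) = of_int (sign p)"
    for p :: "'a \<Rightarrow> 'a"
    by (cases p rule: sign_cases) (auto simp: evaluable_1 evaluable_uminus)
  have "evaluable v (of_int (sign p) * (\<Prod>i\<in>UNIV. A $ i $ p i)) \<and>
      rat_eval v (of_int (sign p) * (\<Prod>i\<in>UNIV. A $ i $ p i)) =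
      of_int (sign p) * (\<Prod>i\<in>UNIV. eval_mat v A $ i $ p i)" for p
    using evaluable_mult[of v "of_int (sign p)" "\<Prod>i\<in>UNIV. A $ i $ p i"]
      evaluable_prod[of UNIV v "\<lambda>i. A $ i $ p i"] assms sgn[of p]
    by (simp add: eval_mat_def)
  then show "evaluable v (det A)" "rat_eval v (det A) = det (eval_mat v A)"
    unfolding det_def by (simp_all add: evaluable_sum)
qed

lemma evaluable_orbit:
  "evaluable v ((cmat g *v Xvec) $ i)" "rat_eval v ((cmat g *v Xvec) $ i) = (g *v v) $ i"
proof -
  have "evaluable v (cmat g $ i $ j * Xvec $ j) \<and>
      rat_eval v (cmat g $ i $ j * Xvec $ j) = g $ i $ j * v $ j" for j
    using evaluable_mult[of v "cmat g $ i $ j" "Xvec $ j"] by (simp add: cmat_def)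
  then show "evaluable v ((cmat g *v Xvec) $ i)" "rat_eval v ((cmat g *v Xvec) $ i) = (g *v v) $ i"
    by (simp_all add: matrix_vector_mult_def evaluable_sum)
qed

lemma generating_point_basis:
  fixes G :: "(real ^ 'n::{finite,linorder} ^ 'n::_) set"
  assumes "generating_point G v"
  obtains h :: "'n \<Rightarrow> real ^ 'n::_ ^ 'n::_" where "range h \<subseteq> G"
    "evaluable v (det (\<chi> i. cmat (h i) *v Xvec))" "rat_eval v (det (\<chi> i. cmat (h i) *v Xvec)) \<noteq> 0"
proof -
  have "span (orbit_of G v) = UNIV"
    using affine_hull_subset_span[of "orbit_of G v"] assms by (auto simp: generating_point_def)
  then obtain B where B: "B \<subseteq> orbit_of G v" "independent B" "span B = UNIV"
    by (metis maximal_independent_subset span_mono span_span top.extremum_uniqueI)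
  have fin: "finite B"
    using B(2) by (rule independent_imp_finite)
  moreover have "card B = CARD('n)"
    using B by (metis DIM_cart DIM_real dim_UNIV dim_span_eq_card_independent mult.right_neutral)
  ultimately obtain b :: "'n \<Rightarrow> real ^ 'n::_" where b: "bij_betw b UNIV B"
    by (metis finite_same_card_bij finite)
  have "\<forall>i. \<exists>g\<in>G. b i = g *v v"
    using b B(1) by (force simp: orbit_of_def bij_betw_def)
  then obtain h where h: "\<And>i. h i \<in> G" "\<And>i. b i = h i *v v"
    by metis
  let ?M = "(\<chi> i. cmat (h i) *v Xvec) :: 'n ratfun ^ 'n::_ ^ 'n::_"
  have ev: "eval_mat v ?M = (\<chi> i. b i)"
    by (simp add: vec_eq_iff eval_mat_def h evaluable_orbit)
  have "rows (\<chi> i. b i) = B"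
    using b by (auto simp: rows_def row_def bij_betw_def)
  then have "invertible (\<chi> i. b i)"
    using B(3) matrix_left_invertible_span_rows[of "\<chi> i. b i"] by (auto simp: invertible_left_inverse)
  then have "det (\<chi> i. b i) \<noteq> 0"
    by (simp add: invertible_det_nz)
  with that[of h] h(1) show ?thesis
    using evaluable_det[of v ?M] by (auto simp: evaluable_orbit ev)
qed

lemma matrix_determined:
  fixes A :: "'a::field ^ 'n ^ 'n"
  assumes "det M \<noteq> 0" "\<And>i. A *v (M $ i) = N $ i"
  shows "A $ k = (\<chi> l. det (\<chi> i j. if j = l then N $ i $ k else M $ i $ j) / det M)"
proof -
  have "(M *v (A $ k)) $ i = N $ i $ k" for i
    using assms(2)[of i] by (auto simp: vec_eq_iff matrix_vector_mult_def mult.commute)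
  then have "M *v (A $ k) = (\<chi> i. N $ i $ k)"
    by (simp add: vec_eq_iff)
  then show ?thesis
    using cramer[OF assms(1)] by (simp cong: if_cong)
qed

lemma
  fixes G :: "(real ^ 'n::{finite,linorder} ^ 'n::_) set"
  assumes "generating_point G v" "\<sigma> \<in> LinSym_X G"
  shows D_X_unique: "\<exists>!A. invertible A \<and> (\<forall>g\<in>G. A *v (cmat g *v Xvec) = cmat (\<sigma> g) *v Xvec)"
    and D_X_evaluable: "evaluable v (D_X G \<sigma> $ k $ l)"
proof -
  let ?P = "\<lambda>A. invertible A \<and> (\<forall>g\<in>G. A *v (cmat g *v Xvec) = cmat (\<sigma> g) *v Xvec)"
  obtain h :: "'n \<Rightarrow> real ^ 'n::_ ^ 'n::_" where h: "range h \<subseteq> G"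
    "evaluable v (det (\<chi> i. cmat (h i) *v Xvec))" "rat_eval v (det (\<chi> i. cmat (h i) *v Xvec)) \<noteq> 0"
    by (rule generating_point_basis[OF assms(1)])
  let ?M = "(\<chi> i. cmat (h i) *v Xvec) :: 'n ratfun ^ 'n::_ ^ 'n::_"
  let ?N = "(\<chi> i. cmat (\<sigma> (h i)) *v Xvec) :: 'n ratfun ^ 'n::_ ^ 'n::_"
  have "det ?M \<noteq> 0"
    using h(3) evaluable_0[of v] by auto
  then have row: "A $ k = (\<chi> l. det (\<chi> i j. if j = l then ?N $ i $ k else ?M $ i $ j) / det ?M)"
    if "?P A" for A k
    using that h(1) by (intro matrix_determined) auto
  have eq: "A = B" if "?P A" "?P B" for A B
  proof -
    have "A $ i = B $ i" for i
      by (rule trans[OF row[OF that(1)] row[OF that(2), symmetric]])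
    then show ?thesis
      by (rule vec_eq_iff[THEN iffD2, OF allI])
  qed
  obtain A where A: "?P A"
    using assms(2) unfolding LinSym_X_def LinSym_def by blast
  show ex: "\<exists>!A. ?P A"
    by (rule ex1I[of ?P, OF A]) (rule eq[OF _ A])
  have "?P (D_X G \<sigma>)"
    unfolding D_X_def using ex by (rule theI')
  from arg_cong[OF row[OF this, of k], of "\<lambda>x. x $ l"]
  have "D_X G \<sigma> $ k $ l = det (\<chi> i j. if j = l then ?N $ i $ k else ?M $ i $ j) / det ?M"
    unfolding vec_lambda_beta .
  moreover have "evaluable v (det (\<chi> i j. if j = l then ?N $ i $ k else ?M $ i $ j))"
    by (rule evaluable_det(1)) (simp add: evaluable_orbit)
  ultimately show "evaluable v (D_X G \<sigma> $ k $ l)"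
    using evaluable_divide[OF _ h(2,3)] by simp
qed

end

theory Submission
  imports Defs "HOL-Computational_Algebra.Polynomial"
begin

text \<open>Let \<open>L = LinSym_X G\<close>. The matrix \<open>S = (\<Sum>\<tau>\<in>L. D_X \<tau> ** D_v (inv \<tau>))\<close> intertwines \<open>D_X\<close> with \<open>D_v\<close>,
  and its value at \<open>v\<close> is \<open>\<Sum>\<tau>\<in>L. D_v \<tau> ** D_v (inv \<tau>) = card L * mat 1\<close>, so \<open>det S \<noteq> 0\<close>. No
  character theory is needed. Let \<open>S'\<close> be the corresponding matrix for \<open>w\<close>. On
  the line through \<open>v\<close> and \<open>w\<close>, all but finitely many points \<open>u\<close> lie in the domains of the
  matrices \<open>D_X \<tau>\<close> and satisfy \<open>det S \<noteq> 0\<close> and \<open>det S' \<noteq> 0\<close> at \<open>u\<close>. Evaluation at such a \<open>u\<close>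
  shows that \<open>D_v\<close> and \<open>D_w\<close> are both similar over the reals to \<open>D_u\<close>. Finally, the similarity of
  \<open>D_X\<close> and \<open>D_u\<close> makes evaluation at a generating point \<open>u\<close> injective.\<close>

section \<open>Constant matrices and evaluation\<close>

text \<open>The laws for \<open>eval_mat\<close> below are stated for these matrices, since
  \<open>rat_eval\<close> is unspecified for an entry without a representing fraction whose
  denominator is nonzero at the point.\<close>

definition regular_at :: "real ^ 'n::{finite,linorder} \<Rightarrow> 'n ratfun ^ 'n::_ ^ 'n::_ \<Rightarrow> bool" where
  "regular_at v A \<longleftrightarrow> (\<forall>i j. evaluable v (A $ i $ j))"

lemma eval_mat_nth [simp]: "eval_mat v A $ i $ j = rat_eval v (A $ i $ j)"
  by (simp add: eval_mat_def)

lemma cmat_nth [simp]: "cmat A $ i $ j = rconst (A $ i $ j)"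
  by (simp add: cmat_def)

lemma rconst_add: "rconst (a + b) = rconst a + rconst b"
  by (simp add: rconst_def single_add)

lemma rconst_mult: "rconst (a * b) = rconst a * rconst b"
  by (simp add: rconst_def mult_single)

lemma rconst_0 [simp]: "rconst 0 = 0"
  by (simp add: rconst_def Zero_fract_def)

lemma rconst_1 [simp]: "rconst 1 = 1"
  by (simp add: rconst_def One_fract_def)

lemma rconst_sum: "rconst (sum f S) = (\<Sum>x\<in>S. rconst (f x))"
  by (induction S rule: infinite_finite_induct) (simp_all add: rconst_add)

lemma cmat_mult: "cmat (A ** B) = cmat A ** cmat B"
  by (simp add: vec_eq_iff matrix_matrix_mult_def rconst_sum rconst_mult)

lemma cmat_mat_1 [simp]: "cmat (mat 1) = mat 1"
  by (simp add: vec_eq_iff mat_def)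

lemma regular_at_cmat [simp]: "regular_at v (cmat A)" "eval_mat v (cmat A) = A"
  by (simp_all add: regular_at_def vec_eq_iff)

lemma
  assumes "regular_at v A" "regular_at v B"
  shows regular_at_mult: "regular_at v (A ** B)"
    and eval_mat_mult: "eval_mat v (A ** B) = eval_mat v A ** eval_mat v B"
proof -
  have "evaluable v (A $ i $ k * B $ k $ j) \<and>
      rat_eval v (A $ i $ k * B $ k $ j) = rat_eval v (A $ i $ k) * rat_eval v (B $ k $ j)" for i j k
    using assms by (intro evaluable_mult) (auto simp: regular_at_def)
  then show "regular_at v (A ** B)" "eval_mat v (A ** B) = eval_mat v A ** eval_mat v B"
    by (simp_all add: regular_at_def vec_eq_iff matrix_matrix_mult_def evaluable_sum)
qed

lemma eval_mat_mat_1 [simp]: "eval_mat v (mat 1) = mat 1"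
  using regular_at_cmat(2)[of v "mat 1"] by simp

lemma
  assumes "\<And>x. x \<in> S \<Longrightarrow> regular_at v (f x)"
  shows regular_at_sum: "regular_at v (sum f S)"
    and eval_mat_sum: "eval_mat v (sum f S) = (\<Sum>x\<in>S. eval_mat v (f x))"
  using assms by (simp_all add: regular_at_def vec_eq_iff evaluable_sum)

text \<open>Regularity of the inverse matters: the determinant of an invertible regular matrix may
  still vanish at \<open>v\<close>.\<close>

lemma invertible_eval_mat:
  assumes "regular_at v A" "regular_at v A'" "A ** A' = mat 1"
  shows "invertible (eval_mat v A)"
proof -
  have "eval_mat v A ** eval_mat v A' = mat 1"
    using eval_mat_mult[OF assms(1,2)] assms(3) by simp
  then show ?thesis
    by (auto simp: invertible_right_inverse)
qed

text \<open>The determinant commutes with evaluation, and the zero function has value 0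
  everywhere.\<close>

lemma invertible_if_eval_mat:
  assumes "regular_at v A" "invertible (eval_mat v A)"
  shows "invertible A"
  using assms evaluable_det(2)[of v A] evaluable_0[of v]
  by (auto simp: regular_at_def invertible_det_nz)

lemma eval_mat_mult_orbit:
  assumes "regular_at v A" "A *v (cmat g *v Xvec) = cmat h *v Xvec"
  shows "eval_mat v A *v (g *v v) = h *v v"
proof -
  have "rat_eval v ((A *v (cmat g *v Xvec)) $ i) = (eval_mat v A *v (g *v v)) $ i" for i
  proof -
    have "evaluable v (A $ i $ j * (cmat g *v Xvec) $ j) \<and> rat_eval v (A $ i $ j * (cmat g *v Xvec) $ j)
       = rat_eval v (A $ i $ j) * (g *v v) $ j" for j
      using evaluable_mult[of v "A $ i $ j" "(cmat g *v Xvec) $ j"] assms(1)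
      by (simp add: regular_at_def evaluable_orbit)
    then show ?thesis
      unfolding matrix_vector_mult_def[of A] matrix_vector_mult_def[of "eval_mat v A"]
      by (simp add: evaluable_sum)
  qed
  then show ?thesis
    unfolding assms(2) by (simp add: vec_eq_iff evaluable_orbit)
qed

text \<open>Specialising the variables to every real vector recovers the matrix. Hence
  \<open>G\<close> is in bijection with the orbit of \<open>Xvec\<close>, which later turns
  symmetries of the orbit into permutations of \<open>G\<close>.\<close>

lemma cmat_mult_Xvec_eq_iff: "cmat g *v Xvec = cmat h *v Xvec \<longleftrightarrow> g = h"
proof
  assume "cmat g *v Xvec = cmat h *v Xvec"
  then have "g *v v = h *v v" for v
    using evaluable_orbit(2)[of v g] evaluable_orbit(2)[of v h] by (simp add: vec_eq_iff)
  then show "g = h"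
    by (simp add: matrix_eq)
qed simp


section \<open>Zariski-open conditions on a point\<close>

text \<open>The property holds on a principal Zariski-open neighbourhood of \<open>v\<close>, the
  non-vanishing locus of \<open>q\<close>.\<close>

definition generically_at :: "real ^ 'n::{finite,linorder} \<Rightarrow> (real ^ 'n::_ \<Rightarrow> bool) \<Rightarrow> bool" where
  "generically_at v P \<longleftrightarrow> (\<exists>q. peval v q \<noteq> 0 \<and> (\<forall>u. peval u q \<noteq> 0 \<longrightarrow> P u))"

lemma generically_at_conj:
  assumes "generically_at v P" "generically_at v Q"
  shows "generically_at v (\<lambda>u. P u \<and> Q u)"
proof -
  obtain p q where "peval v p \<noteq> 0" "\<forall>u. peval u p \<noteq> 0 \<longrightarrow> P u"
    "peval v q \<noteq> 0" "\<forall>u. peval u q \<noteq> 0 \<longrightarrow> Q u"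
    using assms unfolding generically_at_def by blast
  then show ?thesis
    unfolding generically_at_def by (intro exI[of _ "p * q"]) (simp add: peval_mult)
qed

lemma generically_at_ball:
  assumes "finite S" "\<And>x. x \<in> S \<Longrightarrow> generically_at v (P x)"
  shows "generically_at v (\<lambda>u. \<forall>x\<in>S. P x u)"
  using assms
proof (induction S)
  case empty
  show ?case
    unfolding generically_at_def by (intro exI[of _ 1]) simp
next
  case (insert x S)
  then show ?case
    using generically_at_conj[of v "P x" "\<lambda>u. \<forall>x\<in>S. P x u"] by simp
qed

lemma generically_at_evaluable:
  assumes "evaluable v f"
  shows "generically_at v (\<lambda>u. evaluable u f)"
  using assms unfolding generically_at_def evaluable_def by blast

lemma generically_at_rat_eval_nonzero:
  assumes "evaluable v f" "rat_eval v f \<noteq> 0"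
  shows "generically_at v (\<lambda>u. rat_eval u f \<noteq> 0)"
proof -
  obtain p q where f: "f = Fract p q" "peval v q \<noteq> 0"
    using assms(1) by (auto elim: evaluable_E)
  moreover have "peval v p \<noteq> 0"
    using assms(2) f by (auto simp: rat_eval_Fract)
  ultimately show ?thesis
    \<comment> \<open>Where \<open>p * q\<close> is nonzero, the denominator does not vanish, so the
      value is the quotient, and its numerator is nonzero.\<close>
    unfolding generically_at_def
    by (intro exI[of _ "p * q"]) (auto simp: peval_mult rat_eval_Fract)
qed

lemma generically_at_regular_at:
  assumes "regular_at v A"
  shows "generically_at v (\<lambda>u. regular_at u A)"
proof -
  have "generically_at v (\<lambda>u. \<forall>i\<in>UNIV. \<forall>j\<in>UNIV. evaluable u (A $ i $ j))"
    using assms by (intro generically_at_ball generically_at_evaluable) (auto simp: regular_at_def)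
  then show ?thesis
    by (simp add: regular_at_def)
qed

lemma generically_at_invertible_eval_mat:
  assumes "regular_at v A" "invertible (eval_mat v A)"
  shows "generically_at v (\<lambda>u. regular_at u A \<and> invertible (eval_mat u A))"
proof -
  have "generically_at v (\<lambda>u. regular_at u A \<and> rat_eval u (det A) \<noteq> 0)"
    using assms evaluable_det[of v A]
    by (intro generically_at_conj generically_at_regular_at generically_at_rat_eval_nonzero)
      (auto simp: regular_at_def invertible_det_nz)
  \<comment> \<open>Regularity at \<open>u\<close> lets the determinant commute with evaluation
    there, so it is kept as a conjunct.\<close>
  moreover have "regular_at u A \<and> rat_eval u (det A) \<noteq> 0 \<longleftrightarrow>
      regular_at u A \<and> invertible (eval_mat u A)" for u
    using evaluable_det(2)[of u A] by (auto simp: regular_at_def invertible_det_nz)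
  ultimately show ?thesis
    by simp
qed

text \<open>Restriction to a line reduces non-vanishing in several variables to the finiteness of
  the roots of a univariate polynomial.\<close>

lemma peval_line:
  obtains P where "\<And>t. poly P t = peval (v + t *s (w - v)) p"
proof
  show "poly (\<Sum>m\<in>Poly_Mapping.keys p. smult (poly_mapping.lookup p m)
        (\<Prod>i\<in>UNIV. [:v $ i, w $ i - v $ i:] ^ poly_mapping.lookup m i)) t
      = peval (v + t *s (w - v)) p" for t
    by (simp add: peval_def poly_sum poly_prod right_diff_distrib)
qed

text \<open>Nonempty Zariski-open sets meet, here already on the line through \<open>v\<close> and \<open>w\<close>.\<close>

lemma generically_at_common_point:
  assumes "generically_at v P" "generically_at w Q"
  obtains u where "P u" "Q u"
proof -
  obtain p q where p: "peval v p \<noteq> 0" "\<forall>u. peval u p \<noteq> 0 \<longrightarrow> P u"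
    and q: "peval w q \<noteq> 0" "\<forall>u. peval u q \<noteq> 0 \<longrightarrow> Q u"
    using assms unfolding generically_at_def by blast
  obtain p' q' where p': "\<And>t. poly p' t = peval (v + t *s (w - v)) p"
    and q': "\<And>t. poly q' t = peval (v + t *s (w - v)) q"
    by (metis peval_line)
  \<comment> \<open>The parameter 0 gives \<open>v\<close> and the parameter 1 gives
    \<open>w\<close>.\<close>
  have "p' \<noteq> 0" "q' \<noteq> 0"
    using p(1) p'[of 0] q(1) q'[of 1] by auto
  then have "finite {t. poly (p' * q') t = 0}"
    by (intro poly_roots_finite) simp
  then obtain t where "poly (p' * q') t \<noteq> 0"
    using infinite_UNIV_char_0 by (metis (mono_tags, lifting) UNIV_eq_I mem_Collect_eq)
  then show ?thesis
    using that p(2) q(2) p'[of t] q'[of t] by auto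
qed


section \<open>The representations\<close>

lemma matrix_mult_sum_left:
  fixes A :: "'a::comm_ring_1 ^ 'n ^ 'n"
  shows "A ** (\<Sum>x\<in>S. f x) = (\<Sum>x\<in>S. A ** f x)"
  by (induction S rule: infinite_finite_induct) (simp_all add: matrix_add_ldistrib)

lemma matrix_mult_sum_right:
  fixes A :: "'a::comm_ring_1 ^ 'n ^ 'n"
  shows "(\<Sum>x\<in>S. f x) ** A = (\<Sum>x\<in>S. f x ** A)"
  by (induction S rule: infinite_finite_induct) (simp_all add: matrix_matrix_mult_def vec_eq_iff sum.distrib distrib_right)

text \<open>Left translation by \<open>\<sigma>\<close> permutes \<open>L\<close>, so the index may
  be replaced by \<open>\<sigma> \<circ> \<tau>\<close>. Then \<open>D \<sigma>\<close> splits off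
  on the left, while on the right the inverse of \<open>\<sigma>\<close> inside \<open>E\<close>
  cancels against \<open>E \<sigma>\<close>.\<close>

lemma intertwiner_sum:
  fixes D E :: "('i \<Rightarrow> 'i) \<Rightarrow> 'a::field ^ 'n ^ 'n"
  assumes "finite L" and comp: "\<And>\<sigma> \<tau>. \<sigma> \<in> L \<Longrightarrow> \<tau> \<in> L \<Longrightarrow> \<sigma> \<circ> \<tau> \<in> L"
    and inv: "\<And>\<sigma>. \<sigma> \<in> L \<Longrightarrow> bij \<sigma> \<and> inv_into UNIV \<sigma> \<in> L"
    and D: "\<And>\<sigma> \<tau>. \<sigma> \<in> L \<Longrightarrow> \<tau> \<in> L \<Longrightarrow> D (\<sigma> \<circ> \<tau>) = D \<sigma> ** D \<tau>"
    and E: "\<And>\<sigma> \<tau>. \<sigma> \<in> L \<Longrightarrow> \<tau> \<in> L \<Longrightarrow> E (\<sigma> \<circ> \<tau>) = E \<sigma> ** E \<tau>"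
    and \<sigma>: "\<sigma> \<in> L"
  shows "D \<sigma> ** (\<Sum>\<tau>\<in>L. D \<tau> ** E (inv_into UNIV \<tau>)) = (\<Sum>\<tau>\<in>L. D \<tau> ** E (inv_into UNIV \<tau>)) ** E \<sigma>"
proof -
  have bij: "bij_betw (\<lambda>\<tau>. \<sigma> \<circ> \<tau>) L L"
  proof (rule bij_betw_byWitness[where f' = "\<lambda>\<tau>. inv_into UNIV \<sigma> \<circ> \<tau>"])
    show "\<forall>\<tau>\<in>L. inv_into UNIV \<sigma> \<circ> (\<sigma> \<circ> \<tau>) = \<tau>" "\<forall>\<tau>\<in>L. \<sigma> \<circ> (inv_into UNIV \<sigma> \<circ> \<tau>) = \<tau>"
      using inv[OF \<sigma>] by (auto simp: fun_eq_iff bij_is_inj bij_is_surj surj_f_inv_f)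
  qed (use \<sigma> comp inv in auto)
  have "(\<Sum>\<tau>\<in>L. D \<tau> ** E (inv_into UNIV \<tau>)) ** E \<sigma> = (\<Sum>\<tau>\<in>L. D \<tau> ** E (inv_into UNIV \<tau>) ** E \<sigma>)"
    by (rule matrix_mult_sum_right)
  also have "\<dots> = (\<Sum>\<tau>\<in>L. D (\<sigma> \<circ> \<tau>) ** E (inv_into UNIV (\<sigma> \<circ> \<tau>)) ** E \<sigma>)"
    by (rule sum.reindex_bij_betw[OF bij, symmetric])
  also have "\<dots> = (\<Sum>\<tau>\<in>L. D \<sigma> ** (D \<tau> ** E (inv_into UNIV \<tau>)))"
  proof (rule sum.cong)
    fix \<tau> assume \<tau>: "\<tau> \<in> L"
    have "E (inv_into UNIV (\<sigma> \<circ> \<tau>)) ** E \<sigma> = E (inv_into UNIV (\<sigma> \<circ> \<tau>) \<circ> \<sigma>)"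
      using E comp inv \<sigma> \<tau> by simp
    also have "inv_into UNIV (\<sigma> \<circ> \<tau>) \<circ> \<sigma> = inv_into UNIV \<tau>"
      using inv[OF \<sigma>] inv[OF \<tau>] by (simp add: o_inv_distrib fun_eq_iff bij_is_inj)
    finally show "D (\<sigma> \<circ> \<tau>) ** E (inv_into UNIV (\<sigma> \<circ> \<tau>)) ** E \<sigma> = D \<sigma> ** (D \<tau> ** E (inv_into UNIV \<tau>))"
      using D[OF \<sigma> \<tau>] by (simp add: matrix_mul_assoc[symmetric] comp_def)
  qed simp
  also have "\<dots> = D \<sigma> ** (\<Sum>\<tau>\<in>L. D \<tau> ** E (inv_into UNIV \<tau>))"
    by (rule matrix_mult_sum_left[symmetric])
  finally show ?thesis
    by simp
qed

section \<open>The group of linear symmetries\<close>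

lemma LinSym_X_permutes: "\<sigma> \<in> LinSym_X G \<Longrightarrow> \<sigma> permutes G"
  by (simp add: LinSym_X_def LinSym_def)

lemma finite_LinSym_X: "finite G \<Longrightarrow> finite (LinSym_X G)"
  by (rule finite_subset[OF _ finite_permutations]) (auto dest: LinSym_X_permutes)

lemma LinSym_I:
  "\<sigma> permutes I \<Longrightarrow> invertible A \<Longrightarrow> (\<And>i. i \<in> I \<Longrightarrow> A *v v i = v (\<sigma> i)) \<Longrightarrow> \<sigma> \<in> LinSym I v"
  by (auto simp: LinSym_def)

lemma id_in_LinSym: "id \<in> LinSym I v"
  by (rule LinSym_I[where A = "mat 1"]) (auto simp: permutes_id invertible_def)

lemma comp_in_LinSym:
  assumes "\<sigma> \<in> LinSym I v" "\<tau> \<in> LinSym I v"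
  shows "\<sigma> \<circ> \<tau> \<in> LinSym I v"
proof -
  obtain A B where "\<sigma> permutes I" "invertible A" "\<forall>i\<in>I. A *v v i = v (\<sigma> i)"
    "\<tau> permutes I" "invertible B" "\<forall>i\<in>I. B *v v i = v (\<tau> i)"
    using assms by (auto simp: LinSym_def)
  then show ?thesis
    by (intro LinSym_I[where A = "A ** B"])
      (auto simp: permutes_compose invertible_mult permutes_in_image matrix_vector_mul_assoc[symmetric])
qed

lemma inv_in_LinSym:
  assumes "\<sigma> \<in> LinSym I v"
  shows "inv_into UNIV \<sigma> \<in> LinSym I v"
proof -
  obtain A where \<sigma>: "\<sigma> permutes I" and A: "invertible A" "\<forall>i\<in>I. A *v v i = v (\<sigma> i)"
    using assms by (auto simp: LinSym_def)
  obtain B where B: "A ** B = mat 1" "B ** A = mat 1"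
    using A(1) by (auto simp: invertible_def)
  have "B *v v i = v (inv_into UNIV \<sigma> i)" if "i \<in> I" for i
  proof -
    have "inv_into UNIV \<sigma> i \<in> I"
      using \<sigma> that by (simp add: permutes_in_image[OF permutes_inv])
    then have "v i = A *v v (inv_into UNIV \<sigma> i)"
      using A(2) \<sigma> by (simp add: permutes_inverses)
    then show ?thesis
      by (simp add: matrix_vector_mul_assoc B)
  qed
  then show ?thesis
    using \<sigma> B by (intro LinSym_I[where A = B]) (auto simp: permutes_inv invertible_def)
qed

lemma LinSym_X_id: "id \<in> LinSym_X G"
  unfolding LinSym_X_def by (rule id_in_LinSym)

lemma LinSym_X_comp: "\<sigma> \<in> LinSym_X G \<Longrightarrow> \<tau> \<in> LinSym_X G \<Longrightarrow> \<sigma> \<circ> \<tau> \<in> LinSym_X G"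
  unfolding LinSym_X_def by (rule comp_in_LinSym)

lemma LinSym_X_inv:
  assumes "\<tau> \<in> LinSym_X G"
  shows "bij \<tau>" "inv_into UNIV \<tau> \<in> LinSym_X G"
  using assms permutes_bij[OF LinSym_X_permutes[OF assms]] inv_in_LinSym
  by (auto simp: LinSym_X_def)

section \<open>The representations and the intertwiner at a fixed generating point\<close>

context
  fixes G :: "(real ^ 'n::{finite,linorder} ^ 'n::_) set" and v :: "real ^ 'n::_"
  assumes gen: "generating_point G v"
begin

lemma
  assumes "\<sigma> \<in> LinSym_X G"
  shows invertible_D_X: "invertible (D_X G \<sigma>)"
    and D_X_orbit: "g \<in> G \<Longrightarrow> D_X G \<sigma> *v (cmat g *v Xvec) = cmat (\<sigma> g) *v Xvec"
  using theI'[OF D_X_unique[OF gen assms]] unfolding D_X_def by auto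

text \<open>By uniqueness, identifying a value of \<open>D_X\<close> amounts to a check on the orbit
  of \<open>Xvec\<close>. This yields multiplicativity, the value at \<open>id\<close> and the
  description of \<open>GL_stab (orbit_X G)\<close>.\<close>

lemma D_X_eqI:
  assumes "\<sigma> \<in> LinSym_X G" "invertible A"
    "\<And>g. g \<in> G \<Longrightarrow> A *v (cmat g *v Xvec) = cmat (\<sigma> g) *v Xvec"
  shows "D_X G \<sigma> = A"
  using D_X_unique[OF gen assms(1)] invertible_D_X[OF assms(1)] D_X_orbit[OF assms(1)] assms(2,3)
  by blast

lemma regular_at_D_X: "\<sigma> \<in> LinSym_X G \<Longrightarrow> regular_at v (D_X G \<sigma>)"
  by (simp add: regular_at_def D_X_evaluable[OF gen])

lemma D_X_comp:
  assumes "\<sigma> \<in> LinSym_X G" "\<tau> \<in> LinSym_X G"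
  shows "D_X G (\<sigma> \<circ> \<tau>) = D_X G \<sigma> ** D_X G \<tau>"
  using assms
  by (intro D_X_eqI) (auto simp: LinSym_X_comp invertible_mult invertible_D_X D_X_orbit
      matrix_vector_mul_assoc[symmetric] permutes_in_image[OF LinSym_X_permutes])

lemma D_X_id: "D_X G id = mat 1"
  using LinSym_X_id by (intro D_X_eqI) (auto simp: invertible_def)

lemma D_at_comp:
  assumes "\<sigma> \<in> LinSym_X G" "\<tau> \<in> LinSym_X G"
  shows "D_at G v (\<sigma> \<circ> \<tau>) = D_at G v \<sigma> ** D_at G v \<tau>"
  using assms by (simp add: D_at_def D_X_comp eval_mat_mult regular_at_D_X)

lemma D_at_id: "D_at G v id = mat 1"
  by (simp add: D_at_def D_X_id)

text \<open>The real factors enter as constant matrices, so evaluation at another point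
  \<open>u\<close> affects only the factors \<open>D_X G \<tau>\<close>.\<close>

definition intertwiner :: "'n ratfun ^ 'n::_ ^ 'n::_" where
  "intertwiner = (\<Sum>\<tau>\<in>LinSym_X G. D_X G \<tau> ** cmat (D_at G v (inv_into UNIV \<tau>)))"

lemma D_X_intertwiner:
  assumes "finite G" "\<sigma> \<in> LinSym_X G"
  shows "D_X G \<sigma> ** intertwiner = intertwiner ** cmat (D_at G v \<sigma>)"
  unfolding intertwiner_def
  by (rule intertwiner_sum[where E = "\<lambda>\<sigma>. cmat (D_at G v \<sigma>)"])
    (use assms in \<open>auto simp: finite_LinSym_X LinSym_X_comp LinSym_X_inv D_X_comp D_at_comp cmat_mult\<close>)

lemma regular_at_intertwiner:
  assumes "\<And>\<tau>. \<tau> \<in> LinSym_X G \<Longrightarrow> regular_at u (D_X G \<tau>)"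
  shows "regular_at u intertwiner"
  unfolding intertwiner_def using assms by (intro regular_at_sum regular_at_mult) auto

lemma eval_mat_intertwiner: "eval_mat v intertwiner = mat (of_nat (card (LinSym_X G)))"
proof -
  have "eval_mat v intertwiner = (\<Sum>\<tau>\<in>LinSym_X G. mat 1)"
    unfolding intertwiner_def
  proof (subst eval_mat_sum, goal_cases)
    case 2
    show ?case
    proof (rule sum.cong)
      fix \<tau> assume \<tau>: "\<tau> \<in> LinSym_X G"
      have "eval_mat v (D_X G \<tau> ** cmat (D_at G v (inv_into UNIV \<tau>))) = D_at G v (\<tau> \<circ> inv_into UNIV \<tau>)"
        using \<tau> LinSym_X_inv[OF \<tau>] by (simp add: eval_mat_mult regular_at_D_X D_at_comp) (simp add: D_at_def)
      also have "\<tau> \<circ> inv_into UNIV \<tau> = id"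
        using LinSym_X_inv[OF \<tau>] by (simp add: bij_is_surj surj_iff[symmetric])
      finally show "eval_mat v (D_X G \<tau> ** cmat (D_at G v (inv_into UNIV \<tau>))) = mat 1"
        unfolding D_at_id .
    qed simp
  qed (simp add: regular_at_mult regular_at_D_X)
  then show ?thesis
    unfolding vec_eq_iff sum_component by (simp add: mat_def)
qed

lemma invertible_eval_intertwiner:
  assumes "finite G"
  shows "invertible (eval_mat v intertwiner)"
proof -
  let ?c = "real (card (LinSym_X G))"
  \<comment> \<open>The set contains \<open>id\<close>; its finiteness counts too, because
    \<open>card\<close> of an infinite set is 0.\<close>
  have "?c \<noteq> 0"
    using LinSym_X_id finite_LinSym_X[OF assms] by auto
  then have "mat ?c ** mat (1 / ?c) = (mat 1 :: real ^ 'n::_ ^ 'n::_)"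
    by (simp add: vec_eq_iff mat_def matrix_matrix_mult_def mult_delta_left)
  then show ?thesis
    unfolding eval_mat_intertwiner invertible_right_inverse by blast
qed

lemma invertible_intertwiner: "finite G \<Longrightarrow> invertible intertwiner"
  using invertible_if_eval_mat regular_at_intertwiner regular_at_D_X invertible_eval_intertwiner
  by blast

text \<open>Only finitely many denominators and one determinant must stay nonzero, and all of these
  conditions hold at \<open>v\<close>. At such \<open>u\<close> the intertwining relation can be
  evaluated and its intertwiner remains invertible.\<close>

lemma generically_at_intertwiner:
  assumes "finite G"
  shows "generically_at v (\<lambda>u. (\<forall>\<tau>\<in>LinSym_X G. regular_at u (D_X G \<tau>)) \<and>
    regular_at u intertwiner \<and> invertible (eval_mat u intertwiner))"
  using finite_LinSym_X[OF assms] regular_at_D_X regular_at_intertwiner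
    invertible_eval_intertwiner[OF assms]
  by (intro generically_at_conj[where P = "\<lambda>u. \<forall>\<tau>\<in>LinSym_X G. regular_at u (D_X G \<tau>)"]
      generically_at_ball generically_at_invertible_eval_mat generically_at_regular_at) auto

end

section \<open>Similarity at two generating points\<close>

lemma
  fixes A :: "'a::field ^ 'n ^ 'n"
  assumes "invertible A"
  shows matrix_inv_right: "A ** matrix_inv A = mat 1"
    and matrix_inv_left: "matrix_inv A ** A = mat 1"
  using assms someI_ex[of "\<lambda>A'. A ** A' = mat 1 \<and> A' ** A = mat 1"]
  unfolding invertible_def matrix_inv_def by auto

lemma matrix_inv_conj:
  fixes A B S :: "'a::field ^ 'n ^ 'n"
  assumes "invertible S" "A ** S = S ** B"
  shows "B = matrix_inv S ** A ** S"
proof -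
  have "matrix_inv S ** A ** S = matrix_inv S ** S ** B"
    by (simp add: assms(2) matrix_mul_assoc[symmetric])
  then show ?thesis
    by (simp add: matrix_inv_left[OF assms(1)])
qed

lemma D_at_similar:
  fixes G :: "(real ^ 'n::{finite,linorder} ^ 'n::_) set"
  assumes "finite G" "generating_point G v" "generating_point G w"
  obtains T where "invertible T" "\<And>\<sigma>. \<sigma> \<in> LinSym_X G \<Longrightarrow> D_at G w \<sigma> ** T = T ** D_at G v \<sigma>"
proof -
  let ?S = "intertwiner G v" and ?S' = "intertwiner G w"
  \<comment> \<open>Evaluating \<open>?S\<close> directly at \<open>w\<close> could give a singular
    matrix: its determinant is only known to be nonzero near \<open>v\<close>. A common point serves
    both intertwiners.\<close>
  obtain u where reg: "\<forall>\<tau>\<in>LinSym_X G. regular_at u (D_X G \<tau>)"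
    and u: "regular_at u ?S" "invertible (eval_mat u ?S)"
    and u': "regular_at u ?S'" "invertible (eval_mat u ?S')"
    using generically_at_common_point[OF generically_at_intertwiner[OF assms(2,1)]
        generically_at_intertwiner[OF assms(3,1)]] by metis
  let ?T = "eval_mat u ?S" and ?T' = "eval_mat u ?S'"
  obtain R where R: "?T' ** R = mat 1" "R ** ?T' = mat 1"
    using u'(2) by (auto simp: invertible_def)
  show ?thesis
  \<comment> \<open>Here \<open>?T\<close> carries the representation at \<open>v\<close> to the
    evaluation of \<open>D_X\<close> at \<open>u\<close>, and \<open>R\<close>, the inverse of
    \<open>?T'\<close>, carries that on to the representation at \<open>w\<close>.\<close>
  proof (rule that[of "R ** ?T"])
    show "invertible (R ** ?T)"
      using R u(2) invertible_mult[of R ?T] unfolding invertible_def[of R] by blast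
    fix \<sigma> assume \<sigma>: "\<sigma> \<in> LinSym_X G"
    have eq: "eval_mat u (D_X G \<sigma>) ** eval_mat u (intertwiner G x)
        = eval_mat u (intertwiner G x) ** D_at G x \<sigma>"
      if "generating_point G x" "regular_at u (intertwiner G x)" for x
      using arg_cong[OF D_X_intertwiner[OF that(1) assms(1) \<sigma>], of "eval_mat u"] reg \<sigma> that(2)
      by (simp add: eval_mat_mult)
    have "D_at G w \<sigma> ** (R ** ?T) = (R ** ?T') ** D_at G w \<sigma> ** (R ** ?T)"
      by (simp add: R(2))
    also have "\<dots> = R ** (?T' ** D_at G w \<sigma>) ** (R ** ?T)"
      by (simp only: matrix_mul_assoc)
    also have "\<dots> = R ** eval_mat u (D_X G \<sigma>) ** (?T' ** R) ** ?T"
      by (simp add: eq[OF assms(3) u'(1), symmetric] matrix_mul_assoc)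
    also have "\<dots> = R ** ?T ** D_at G v \<sigma>"
      by (simp add: R(1) matrix_mul_assoc[symmetric] eq[OF assms(2) u(1)])
    finally show "D_at G w \<sigma> ** (R ** ?T) = R ** ?T ** D_at G v \<sigma>" .
  qed
qed


section \<open>Injectivity of evaluation\<close>

text \<open>This is the surjectivity of \<open>D_X\<close> onto the stabiliser of the generic orbit:
  the bijection between \<open>G\<close> and that orbit transports the action of \<open>A\<close> to
  a permutation of \<open>G\<close>.\<close>

lemma GL_stab_orbit_X_cases:
  fixes G :: "(real ^ 'n::{finite,linorder} ^ 'n::_) set"
  assumes "generating_point G u" "A \<in> carrier (GL_stab (orbit_X G))"
  obtains \<sigma> where "\<sigma> \<in> LinSym_X G" "A = D_X G \<sigma>"
proof -
  have A: "invertible A" "(\<lambda>x. A *v x) ` orbit_X G = orbit_X G"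
    using assms(2) by (auto simp: GL_stab_def)
  have inj_A: "inj (\<lambda>x. A *v x)"
    using A(1) by (rule inj_matrix_vector_mult)
  have bij: "bij_betw (\<lambda>g. cmat g *v Xvec) G (orbit_X G)"
    by (auto simp: bij_betw_def inj_on_def cmat_mult_Xvec_eq_iff orbit_X_def orbit_of_def)
  let ?f = "\<lambda>g. cmat g *v Xvec"
  \<comment> \<open>Outside \<open>G\<close> the function is the identity, as
    \<open>permutes\<close> demands.\<close>
  define \<sigma> where "\<sigma> = (\<lambda>g. if g \<in> G then inv_into G ?f (A *v ?f g) else g)"
  have "bij_betw (\<lambda>x. A *v x) (orbit_X G) (orbit_X G)"
    using A(2) inj_A by (auto simp: bij_betw_def intro: inj_on_subset)
  then have "bij_betw (inv_into G ?f \<circ> ((\<lambda>x. A *v x) \<circ> ?f)) G G"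
    by (intro bij_betw_trans[OF bij_betw_trans[OF bij] bij_betw_inv_into[OF bij]])
  then have "bij_betw \<sigma> G G"
    by (rule bij_betw_cong[THEN iffD1, rotated]) (simp add: \<sigma>_def)
  then have perm: "\<sigma> permutes G"
    by (rule bij_imp_permutes) (simp add: \<sigma>_def)
  have orb: "A *v ?f g = ?f (\<sigma> g)" if "g \<in> G" for g
  proof -
    have "A *v ?f g \<in> orbit_X G"
      using imageI[of "?f g" "orbit_X G" "\<lambda>x. A *v x"] A(2) bij_betwE[OF bij] that by simp
    then show ?thesis
      using bij_betw_inv_into_right[OF bij] that by (simp add: \<sigma>_def)
  qed
  have "\<sigma> \<in> LinSym_X G"
    unfolding LinSym_X_def using perm A(1) orb by (rule LinSym_I)
  then show ?thesis
    using D_X_eqI[OF assms(1) _ A(1) orb] that by metis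
qed

lemma eval_mat_in_GL_stab:
  fixes G :: "(real ^ 'n::{finite,linorder} ^ 'n::_) set"
  assumes "generating_point G u" "\<sigma> \<in> LinSym_X G"
  shows "eval_mat u (D_X G \<sigma>) \<in> carrier (GL_stab (orbit_of G u))"
proof -
  \<comment> \<open>The inverse of \<open>D_X G \<sigma>\<close> is again a value of
    \<open>D_X\<close>, hence regular at \<open>u\<close>, so invertibility survives
    evaluation.\<close>
  have "D_X G \<sigma> ** D_X G (inv_into UNIV \<sigma>) = D_X G (\<sigma> \<circ> inv_into UNIV \<sigma>)"
    using D_X_comp[OF assms(1)] assms(2) LinSym_X_inv(2)[OF assms(2)] by simp
  also have "\<sigma> \<circ> inv_into UNIV \<sigma> = id"
    using LinSym_X_inv(1)[OF assms(2)] by (simp add: bij_is_surj surj_iff[symmetric])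
  also have "D_X G id = mat 1"
    by (rule D_X_id[OF assms(1)])
  finally have "invertible (eval_mat u (D_X G \<sigma>))"
    using regular_at_D_X[OF assms(1)] assms(2) LinSym_X_inv(2)[OF assms(2)]
    by (intro invertible_eval_mat[where A' = "D_X G (inv_into UNIV \<sigma>)"])
  moreover have "eval_mat u (D_X G \<sigma>) *v (g *v u) = \<sigma> g *v u" if "g \<in> G" for g
    using that assms by (intro eval_mat_mult_orbit regular_at_D_X D_X_orbit) auto
  then have "(\<lambda>x. eval_mat u (D_X G \<sigma>) *v x) ` orbit_of G u = (\<lambda>g. \<sigma> g *v u) ` G"
    by (simp add: orbit_of_def image_image)
  moreover have "(\<lambda>g. \<sigma> g *v u) ` G = orbit_of G u"
    using permutes_image[OF LinSym_X_permutes[OF assms(2)]]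
    by (simp add: orbit_of_def image_image[of "\<lambda>g. g *v u" \<sigma> G, symmetric])
  ultimately show ?thesis
    by (simp add: GL_stab_def)
qed

lemma mult_GL_stab [simp]: "A \<otimes>\<^bsub>GL_stab X\<^esub> B = A ** B"
  by (simp add: GL_stab_def)

text \<open>Conjugating the constant matrix \<open>cmat (eval_mat u A)\<close> by the intertwiner at
  \<open>u\<close> gives \<open>A\<close> back, so evaluation has a left inverse on the
  stabiliser.\<close>

lemma eval_mat_mon:
  fixes G :: "(real ^ 'n::{finite,linorder} ^ 'n::_) set"
  assumes "finite G" "generating_point G u"
  shows "eval_mat u \<in> mon (GL_stab (orbit_X G)) (GL_stab (orbit_of G u))"
proof -
  note cases = GL_stab_orbit_X_cases[OF assms(2)]
  have reg: "regular_at u A" if "A \<in> carrier (GL_stab (orbit_X G))" for A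
    using that by (metis cases regular_at_D_X[OF assms(2)])
  have "A = intertwiner G u ** cmat (eval_mat u A) ** matrix_inv (intertwiner G u)"
    if A: "A \<in> carrier (GL_stab (orbit_X G))" for A
  proof -
    obtain \<sigma> where "\<sigma> \<in> LinSym_X G" "A = D_X G \<sigma>"
      by (rule cases[OF A])
    then have "A ** intertwiner G u = intertwiner G u ** cmat (eval_mat u A)"
      using D_X_intertwiner[OF assms(2,1)] by (simp add: D_at_def)
    then have "intertwiner G u ** cmat (eval_mat u A) ** matrix_inv (intertwiner G u)
        = A ** (intertwiner G u ** matrix_inv (intertwiner G u))"
      by (simp add: matrix_mul_assoc)
    then show ?thesis
      by (simp add: matrix_inv_right[OF invertible_intertwiner[OF assms(2,1)]])
  qed
  then have "inj_on (eval_mat u) (carrier (GL_stab (orbit_X G)))"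
    by (metis inj_onI)
  moreover have "eval_mat u A \<in> carrier (GL_stab (orbit_of G u))"
    if "A \<in> carrier (GL_stab (orbit_X G))" for A
    using that by (metis cases eval_mat_in_GL_stab[OF assms(2)])
  ultimately show ?thesis
    using reg by (auto simp: mon_def hom_def eval_mat_mult)
qed

theorem theorem5p3:
  fixes G :: "(real ^ 'n::{finite,linorder} ^ 'n::_) set"
    and v w :: "real ^ 'n::_"
  assumes "subgroup G GL" and "finite G"
    and "generating_point G v" and "generating_point G w"
  shows "(\<exists>(S :: 'n ratfun ^ 'n::_ ^ 'n::_) (T :: real ^ 'n::_ ^ 'n::_). invertible S \<and> invertible T \<and>
            (\<forall>\<sigma>\<in>LinSym_X G.
               cmat (D_at G v \<sigma>) = matrix_inv S ** D_X G \<sigma> ** S \<and>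
               D_at G v \<sigma> = matrix_inv T ** D_at G w \<sigma> ** T))
       \<and> (\<forall>u. generating_point G u \<longrightarrow>
            eval_mat u \<in> mon (GL_stab (orbit_X G)) (GL_stab (orbit_of G u)))"
proof -
  obtain T where T: "invertible T" "\<And>\<sigma>. \<sigma> \<in> LinSym_X G \<Longrightarrow> D_at G w \<sigma> ** T = T ** D_at G v \<sigma>"
    using D_at_similar[OF assms(2-4)] by blast
  note S = invertible_intertwiner[OF assms(3,2)] D_X_intertwiner[OF assms(3,2)]
  show ?thesis
    by (intro conjI exI[of _ "intertwiner G v"] exI[of _ T] ballI allI impI)
      (use S T in \<open>auto intro: matrix_inv_conj eval_mat_mon[OF assms(2)]\<close>)
qed

end
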